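(* Let $\tau\in(0,1)$. For each $m\ge1$ let $P_{0,m},P_{1,m}$ be probability measures on a measurable space $\mathcal Y_m$ with $P_{1,m}\ll P_{0,m}$ and $\rho_m^2:=\chi^2(P_{1,m}\Vert P_{0,m})<\infty$, let $\alpha_m\in[0,1]$, and let $Q_m=(1-\alpha_m)P_{0,m}+\alpha_mP_{1,m}$. Let $(\phi_m)_{m\ge1}$ be any sequence of tests, $\phi_m:\mathcal Y_m^m\to[0,1]$ measurable, of asymptotic level $\tau$, i.e. $\limsup_{m\to\infty}\mathbb E_{P_{0,m}^{\otimes m}}[\phi_m]\le\tau$, and let $\pi_m(\alpha_m)=\mathbb E_{Q_m^{\otimes m}}[\phi_m]$ be its power. (i) If $\alpha_m\rho_m\sqrt m\to0$, then $\limsup_{m\to\infty}\pi_m(\alpha_m)\le\tau$. (ii) Consequently, a necessary order for nontrivial power is $\alpha_m=\Omega\bigl(1/(\rho_m\sqrt m)\bigr)$: if $\liminf_{m\to\infty}\pi_m(\alpha_m)>\tau$, then $\liminf_{m\to\infty}\alpha_m\rho_m\sqrt m>0$.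
   Context: $\chi^2(P_1\Vert P_0)=\mathbb E_{P_0}[(\mathrm dP_1/\mathrm dP_0-1)^2]$ for $P_1\ll P_0$. A test is a measurable $[0,1]$-valued function of the $m$ i.i.d. observations (value = rejection probability); the observations have joint law $P_{0,m}^{\otimes m}$ under the null and $Q_m^{\otimes m}$ under the alternative. *)

theory Defs
  imports "HOL-Probability.Probability"
begin

text \<open>The value lies in the extended nonnegative reals, so that it may be infinite.
  It is meaningful only if \<open>P1\<close> is absolutely continuous with respect to \<open>P0\<close>
  (\<open>absolutely_continuous P0 P1\<close> in the argument order of the library) and both
  are finite; the derivative is then finite almost everywhere, so that \<open>enn2real\<close>
  changes it only on a null set.\<close>

definition chi_square_div :: "'a measure \<Rightarrow> 'a measure \<Rightarrow> ennreal" where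
  "chi_square_div P1 P0 =
     (\<integral>\<^sup>+ y. ennreal ((enn2real (RN_deriv P0 P1 y) - 1)\<^sup>2) \<partial>P0)"

text \<open>The convex combination \<open>(1 - a) P0 + a P1\<close>, for \<open>a\<close> in the unit interval and
  measures with the same measurable sets.\<close>

definition mixture :: "real \<Rightarrow> 'a measure \<Rightarrow> 'a measure \<Rightarrow> 'a measure" where
  "mixture a P0 P1 =
     measure_of (space P0) (sets P0)
       (\<lambda>A. ennreal (1 - a) * emeasure P0 A + ennreal a * emeasure P1 A)"

lemma space_mixture [simp]: "space (mixture a P0 P1) = space P0"
  unfolding mixture_def by simp

lemma sets_mixture [simp]: "sets (mixture a P0 P1) = sets P0"
  unfolding mixture_def by simp

lemma emeasure_mixture:
  assumes "sets P1 = sets P0" and A: "A \<in> sets P0"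
  shows "emeasure (mixture a P0 P1) A =
    ennreal (1 - a) * emeasure P0 A + ennreal a * emeasure P1 A"
proof (rule emeasure_measure_of[OF mixture_def])
  let ?mu = "\<lambda>A. ennreal (1 - a) * emeasure P0 A + ennreal a * emeasure P1 A"
  show "sets P0 \<subseteq> Pow (space P0)" by (rule sets.space_closed)
  show "positive (sets (mixture a P0 P1)) ?mu" by (simp add: positive_def)
  show "countably_additive (sets (mixture a P0 P1)) ?mu"
  proof (rule countably_additiveI)
    fix B :: "nat \<Rightarrow> 'a set"
    assume B: "range B \<subseteq> sets (mixture a P0 P1)" "disjoint_family B"
    then have "(\<Sum>i. emeasure P0 (B i)) = emeasure P0 (\<Union>i. B i)"
      and "(\<Sum>i. emeasure P1 (B i)) = emeasure P1 (\<Union>i. B i)"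
      using assms(1) by (auto intro!: suminf_emeasure)
    then show "(\<Sum>i. ?mu (B i)) = ?mu (\<Union>i. B i)"
      by (simp flip: suminf_add)
  qed
  show "A \<in> sets (mixture a P0 P1)" using A by simp
qed

lemma prob_space_mixture:
  assumes "prob_space P0" "prob_space P1" "sets P1 = sets P0" "0 \<le> a" "a \<le> 1"
  shows "prob_space (mixture a P0 P1)"
proof (rule prob_spaceI)
  have "space P1 = space P0" using assms(3) by (rule sets_eq_imp_space_eq)
  then show "emeasure (mixture a P0 P1) (space (mixture a P0 P1)) = 1"
    using assms prob_space.emeasure_space_1[of P0] prob_space.emeasure_space_1[of P1]
    by (simp add: emeasure_mixture flip: ennreal_plus)
qed

text \<open>The space of \<open>m\<close> observations consists of the extensional functions on
  \<open>{..<m}\<close> with values in the observation space.\<close>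

abbreviation iid :: "nat \<Rightarrow> 'a measure \<Rightarrow> (nat \<Rightarrow> 'a) measure" where
  "iid m P \<equiv> PiM {..<m} (\<lambda>_. P)"

definition is_test :: "nat \<Rightarrow> 'a measure \<Rightarrow> ((nat \<Rightarrow> 'a) \<Rightarrow> real) \<Rightarrow> bool" where
  "is_test m Y \<phi> \<longleftrightarrow>
     \<phi> \<in> borel_measurable (iid m Y) \<and> (\<forall>y \<in> space (iid m Y). 0 \<le> \<phi> y \<and> \<phi> y \<le> 1)"

end

theory Submission
  imports Defs
begin

text \<open>The likelihood ratio \<open>L\<close> of \<open>Q\<^sup>m\<close> with respect to \<open>P0\<^sup>m\<close> is the product of the single
  likelihood ratios \<open>q = 1 + \<alpha> (dP1/dP0 - 1)\<close>, so its second moment is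
  \<open>(1 + \<alpha>\<^sup>2 \<rho>\<^sup>2) ^ m \<le> exp (m \<alpha>\<^sup>2 \<rho>\<^sup>2)\<close>. By the Cauchy--Schwarz inequality, the power of a test exceeds its
  level by \<open>E ((L - 1) \<phi>) \<le> sqrt (exp (m \<alpha>\<^sup>2 \<rho>\<^sup>2) - 1)\<close> at most. Both claims follow from this
  bound, which depends on \<open>\<alpha> \<rho> sqrt m\<close> only.\<close>

text \<open>Both measures agree on boxes, where the integral of a product factorises by Fubini, and
  for a finite index set boxes determine the product measure. Sigma-finiteness of the
  \<open>M i\<close> serves the factorisation, that of the densities the uniqueness.\<close>

lemma PiM_density:
  fixes M :: "'i \<Rightarrow> 'a measure" and f :: "'i \<Rightarrow> 'a \<Rightarrow> ennreal"
  assumes M: "\<And>i. sigma_finite_measure (M i)"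
    and N: "\<And>i. sigma_finite_measure (density (M i) (f i))"
    and [measurable]: "\<And>i. f i \<in> borel_measurable (M i)"
    and I[simp]: "finite I"
  shows "PiM I (\<lambda>i. density (M i) (f i)) = density (PiM I M) (\<lambda>x. \<Prod>i\<in>I. f i (x i))"
proof -
  interpret M: product_sigma_finite M
    using M by (simp add: product_sigma_finite_def)
  interpret N: product_sigma_finite "\<lambda>i. density (M i) (f i)"
    using N by (simp add: product_sigma_finite_def)
  show ?thesis
  proof (rule N.PiM_eqI[symmetric])
    show "sets (density (PiM I M) (\<lambda>x. \<Prod>i\<in>I. f i (x i))) = sets (PiM I (\<lambda>i. density (M i) (f i)))"
      by (simp cong: sets_PiM_cong)
  next
    fix A assume "\<And>i. i \<in> I \<Longrightarrow> A i \<in> sets (density (M i) (f i))"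
    then have A[measurable]: "\<And>i. i \<in> I \<Longrightarrow> A i \<in> sets (M i)" by simp
    have "emeasure (density (PiM I M) (\<lambda>x. \<Prod>i\<in>I. f i (x i))) (Pi\<^sub>E I A)
      = (\<integral>\<^sup>+x. (\<Prod>i\<in>I. f i (x i)) * indicator (Pi\<^sub>E I A) x \<partial>PiM I M)"
      by (rule emeasure_density) (auto intro!: sets_PiM_I_finite A)
    also have "\<dots> = (\<integral>\<^sup>+x. (\<Prod>i\<in>I. f i (x i) * indicator (A i) (x i)) \<partial>PiM I M)"
    proof (rule nn_integral_cong)
      fix x assume "x \<in> space (PiM I M)"
      \<comment> \<open>Points of the product space are already extensional, so membership in the
        box is decided by the coordinates in \<open>I\<close> alone.\<close>
      then have "x \<in> extensional I" by (auto simp: space_PiM PiE_def)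
      then have "indicator (Pi\<^sub>E I A) x = (\<Prod>i\<in>I. indicator (A i) (x i) :: ennreal)"
        by (auto simp: indicator_def PiE_def Pi_def)
      then show "(\<Prod>i\<in>I. f i (x i)) * indicator (Pi\<^sub>E I A) x
          = (\<Prod>i\<in>I. f i (x i) * indicator (A i) (x i))"
        by (simp add: prod.distrib)
    qed
    also have "\<dots> = (\<Prod>i\<in>I. \<integral>\<^sup>+y. f i y * indicator (A i) y \<partial>M i)"
      by (rule M.product_nn_integral_prod) auto
    also have "\<dots> = (\<Prod>i\<in>I. emeasure (density (M i) (f i)) (A i))"
      by (intro prod.cong refl) (simp add: emeasure_density A)
    finally show "emeasure (density (PiM I M) (\<lambda>x. \<Prod>i\<in>I. f i (x i))) (Pi\<^sub>E I A)
      = (\<Prod>i\<in>I. emeasure (density (M i) (f i)) (A i))" .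
  qed simp
qed

text \<open>The variance is nonnegative; this is Cauchy--Schwarz against the constant 1.\<close>

lemma (in prob_space) abs_expectation_le_sqrt:
  fixes X :: "'a \<Rightarrow> real"
  assumes "integrable M X" "integrable M (\<lambda>x. (X x)\<^sup>2)"
  shows "\<bar>expectation X\<bar> \<le> sqrt (expectation (\<lambda>x. (X x)\<^sup>2))"
  using variance_eq[OF assms] variance_positive[of X] by (intro real_le_rsqrt) simp

text \<open>Change of measure from the product of \<open>P\<close> to that of
  \<open>density P q\<close>: independence turns the moments of the likelihood ratio into
  \<open>m\<close>-th powers. Requiring \<open>q\<close> to be nonnegative everywhere lets
  \<open>ennreal\<close> pass through the product pointwise.\<close>

lemma power_le_level_iid_density:
  fixes q :: "'a \<Rightarrow> real" and \<phi> :: "(nat \<Rightarrow> 'a) \<Rightarrow> real"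
  assumes P: "prob_space P"
    and q[measurable]: "q \<in> borel_measurable P" and q_nonneg: "\<And>x. 0 \<le> q x"
    and q_int: "integrable P q" "(\<integral>x. q x \<partial>P) = 1"
    and q_sq: "integrable P (\<lambda>x. (q x - 1)\<^sup>2)"
    and \<phi>: "is_test m P \<phi>"
  shows "(\<integral>y. \<phi> y \<partial>iid m (density P q))
    \<le> (\<integral>y. \<phi> y \<partial>iid m P) + sqrt ((1 + (\<integral>x. (q x - 1)\<^sup>2 \<partial>P)) ^ m - 1)"
proof -
  interpret P: prob_space P by fact
  \<comment> \<open>Mean one makes \<open>density P q\<close> a probability measure, hence
    sigma-finite as \<open>PiM_density\<close> demands.\<close>
  have "emeasure (density P q) (space P) = (\<integral>\<^sup>+x. ennreal (q x) \<partial>P)"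
    by (simp add: emeasure_density cong: nn_integral_cong_simp)
  also have "\<dots> = 1"
    using q_int q_nonneg by (simp add: nn_integral_eq_integral)
  finally have "prob_space (density P q)" by (intro prob_spaceI) simp
  then interpret D: prob_space "density P q" .
  interpret PP: product_prob_space "\<lambda>_::nat. P" by unfold_locales
  let ?N = "iid m P"
  interpret N: prob_space ?N by (rule prob_space_PiM) (rule P)
  define L where "L y = (\<Prod>i<m. q (y i))" for y :: "nat \<Rightarrow> 'a"
  have L_nonneg: "0 \<le> L y" for y
    unfolding L_def by (simp add: prod_nonneg q_nonneg)
  have \<phi>_meas[measurable]: "\<phi> \<in> borel_measurable ?N"
    and \<phi>_range: "\<And>y. y \<in> space ?N \<Longrightarrow> 0 \<le> \<phi> y \<and> \<phi> y \<le> 1"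
    using \<phi> by (auto simp: is_test_def)
  have L_meas[measurable]: "L \<in> borel_measurable ?N"
    unfolding L_def by measurable
  \<comment> \<open>The remainder \<open>2 * q x - 1\<close> has mean one because \<open>q\<close>
    does, so the second moment of \<open>q\<close> is that of \<open>q - 1\<close> plus 1. The same
    identity is used in reverse for \<open>L\<close> below.\<close>
  have q2_eq: "(q x)\<^sup>2 = (q x - 1)\<^sup>2 + (2 * q x - 1)" for x
    by (simp add: power2_eq_square algebra_simps)
  have q2_int: "integrable P (\<lambda>x. (q x)\<^sup>2)"
    unfolding q2_eq using q_sq q_int by simp
  have q2_val: "(\<integral>x. (q x)\<^sup>2 \<partial>P) = 1 + (\<integral>x. (q x - 1)\<^sup>2 \<partial>P)"
    unfolding q2_eq using q_sq q_int by (simp add: P.prob_space)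
  have L_int: "integrable ?N L" and L_val: "(\<integral>y. L y \<partial>?N) = 1"
    unfolding L_def using q_int PP.product_integrable_prod[of "{..<m}" "\<lambda>_. q"]
      PP.product_integral_prod[of "{..<m}" "\<lambda>_. q"] by simp_all
  have L2_eq: "(L y)\<^sup>2 = (\<Prod>i<m. (q (y i))\<^sup>2)" for y
    unfolding L_def by (rule prod_power_distrib)
  have L2_int: "integrable ?N (\<lambda>y. (L y)\<^sup>2)"
    and L2_val: "(\<integral>y. (L y)\<^sup>2 \<partial>?N) = (1 + (\<integral>x. (q x - 1)\<^sup>2 \<partial>P)) ^ m"
    unfolding L2_eq using q2_int q2_val PP.product_integrable_prod[of "{..<m}" "\<lambda>_ x. (q x)\<^sup>2"]
      PP.product_integral_prod[of "{..<m}" "\<lambda>_ x. (q x)\<^sup>2"] by simp_all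
  have V_eq: "(L y - 1)\<^sup>2 = (L y)\<^sup>2 - (2 * L y - 1)" for y
    by (simp add: power2_eq_square algebra_simps)
  have V_int: "integrable ?N (\<lambda>y. (L y - 1)\<^sup>2)"
    unfolding V_eq using L_int L2_int by simp
  have V_val: "(\<integral>y. (L y - 1)\<^sup>2 \<partial>?N) = (1 + (\<integral>x. (q x - 1)\<^sup>2 \<partial>P)) ^ m - 1"
    unfolding V_eq using L_int L2_int by (simp add: L_val L2_val N.prob_space)
  have \<phi>_int: "integrable ?N \<phi>"
    by (rule N.integrable_const_bound[where B = 1]) (auto simp: \<phi>_range)
  have L\<phi>_int: "integrable ?N (\<lambda>y. L y * \<phi> y)"
    by (rule Bochner_Integration.integrable_bound[OF L_int])
      (auto simp: L_nonneg \<phi>_range abs_mult intro!: mult_left_le)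
  \<comment> \<open>The factor \<open>\<phi> y\<close> in the unit interval only shrinks the square;
    this gives both integrability and the final comparison.\<close>
  have X_sq_le: "((L y - 1) * \<phi> y)\<^sup>2 \<le> (L y - 1)\<^sup>2" if "y \<in> space ?N" for y
    using \<phi>_range[OF that] by (simp add: power_mult_distrib mult_left_le power_le_one)
  have X_int: "integrable ?N (\<lambda>y. (L y - 1) * \<phi> y)"
    using L\<phi>_int \<phi>_int by (simp add: left_diff_distrib)
  have X2_int: "integrable ?N (\<lambda>y. ((L y - 1) * \<phi> y)\<^sup>2)"
    by (rule Bochner_Integration.integrable_bound[OF V_int]) (auto simp: X_sq_le)
  have "iid m (density P q) = density ?N (\<lambda>y. \<Prod>i<m. ennreal (q (y i)))"
    by (rule PiM_density) (auto intro: P.sigma_finite_measure_axioms D.sigma_finite_measure_axioms)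
  also have "\<dots> = density ?N (\<lambda>y. ennreal (L y))"
    by (simp add: L_def prod_ennreal q_nonneg)
  finally have "(\<integral>y. \<phi> y \<partial>iid m (density P q)) = (\<integral>y. L y * \<phi> y \<partial>?N)"
    by (simp add: integral_density L_nonneg)
  also have "\<dots> = (\<integral>y. \<phi> y \<partial>?N) + (\<integral>y. (L y - 1) * \<phi> y \<partial>?N)"
    using L\<phi>_int \<phi>_int by (simp add: left_diff_distrib)
  also have "(\<integral>y. (L y - 1) * \<phi> y \<partial>?N) \<le> sqrt (\<integral>y. ((L y - 1) * \<phi> y)\<^sup>2 \<partial>?N)"
    using N.abs_expectation_le_sqrt[OF X_int X2_int] by linarith
  also have "\<dots> \<le> sqrt (\<integral>y. (L y - 1)\<^sup>2 \<partial>?N)"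
    by (intro real_sqrt_le_mono integral_mono X2_int V_int X_sq_le)
  finally show ?thesis by (simp add: V_val)
qed

text \<open>By Radon--Nikodym the mixture has density \<open>(1 - a) + a * f\<close>, with
  \<open>f\<close> the derivative. Writing it as \<open>1 + a * (f - 1)\<close> exposes its
  deviation from 1 as \<open>a\<close> times that of \<open>f\<close>.\<close>

lemma mixture_eq_density:
  assumes "prob_space P0" "prob_space P1" and s: "sets P1 = sets P0"
    and ac: "absolutely_continuous P0 P1" and a: "0 \<le> a" "a \<le> 1"
  shows "mixture a P0 P1
    = density P0 (\<lambda>x. ennreal (1 + a * (enn2real (RN_deriv P0 P1 x) - 1)))"
proof (rule measure_eqI)
  interpret P0: prob_space P0 by fact
  interpret P1: prob_space P1 by fact
  let ?f = "RN_deriv P0 P1"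
  \<comment> \<open>Where the derivative is infinite, \<open>enn2real\<close> returns 0 and the
    identity \<open>eq\<close> may fail; sigma-finiteness of \<open>P1\<close> makes this a null
    set.\<close>
  have fin: "AE x in P0. ?f x \<noteq> \<infinity>"
    by (rule P0.RN_deriv_finite) (use s ac P1.sigma_finite_measure_axioms in auto)
  have eq: "AE x in P0. ennreal (1 + a * (enn2real (?f x) - 1)) = ennreal (1 - a) + ennreal a * ?f x"
    using fin
  proof eventually_elim
    case (elim x)
    then obtain r where r: "?f x = ennreal r" "0 \<le> r" by (cases "?f x") auto
    \<comment> \<open>Here both summands are nonnegative, so \<open>ennreal\<close> distributes over
      the sum; \<open>r - 1\<close> may be negative.\<close>
    have "1 + a * (r - 1) = (1 - a) + a * r" by (simp add: algebra_simps)
    with r have "1 + a * (enn2real (?f x) - 1) = (1 - a) + a * r" by simp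
    then show ?case using r a by (simp only: ennreal_plus ennreal_mult mult_nonneg_nonneg diff_ge_0_iff_ge)
  qed
  fix A assume "A \<in> sets (mixture a P0 P1)"
  then have A[measurable]: "A \<in> sets P0" by simp
  have "emeasure (density P0 (\<lambda>x. ennreal (1 + a * (enn2real (?f x) - 1)))) A
    = (\<integral>\<^sup>+x. ennreal (1 + a * (enn2real (?f x) - 1)) * indicator A x \<partial>P0)"
    by (simp add: emeasure_density)
  also have "\<dots> = (\<integral>\<^sup>+x. ennreal (1 - a) * indicator A x + ennreal a * (?f x * indicator A x) \<partial>P0)"
    by (rule nn_integral_cong_AE) (use eq in eventually_elim, simp add: distrib_right mult.assoc)
  also have "\<dots> = ennreal (1 - a) * emeasure P0 A + ennreal a * emeasure (density P0 ?f) A"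
    by (simp add: nn_integral_add nn_integral_cmult emeasure_density)
  also have "density P0 ?f = P1"
    by (rule P0.density_RN_deriv) (use s ac in auto)
  finally show "emeasure (mixture a P0 P1) A
    = emeasure (density P0 (\<lambda>x. ennreal (1 + a * (enn2real (?f x) - 1)))) A"
    using emeasure_mixture[OF s A] by simp
qed simp

text \<open>The mixture density deviates from 1 by \<open>a * (f - 1)\<close>, whose second moment
  is \<open>(a * \<rho>)\<^sup>2\<close>; \<open>1 + x \<le> exp x\<close> then merges
  \<open>a\<close>, \<open>\<rho>\<close> and \<open>m\<close> into one quantity.\<close>

lemma power_le_level_iid_mixture:
  fixes a \<rho> :: real and \<phi> :: "(nat \<Rightarrow> 'a) \<Rightarrow> real"
  assumes P0: "prob_space P0" and P1: "prob_space P1" and s: "sets P1 = sets P0"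
    and ac: "absolutely_continuous P0 P1"
    and chi: "chi_square_div P1 P0 < \<infinity>" and \<rho>: "\<rho> = sqrt (enn2real (chi_square_div P1 P0))"
    and a: "0 \<le> a" "a \<le> 1" and \<phi>: "is_test m P0 \<phi>"
  shows "(\<integral>y. \<phi> y \<partial>iid m (mixture a P0 P1))
    \<le> (\<integral>y. \<phi> y \<partial>iid m P0) + sqrt (exp ((a * \<rho> * sqrt m)\<^sup>2) - 1)"
proof -
  interpret P0: prob_space P0 by fact
  interpret P1: prob_space P1 by fact
  define f where "f x = enn2real (RN_deriv P0 P1 x)" for x
  have [measurable]: "f \<in> borel_measurable P0" unfolding f_def by measurable
  have f_nonneg: "0 \<le> f x" for x by (simp add: f_def)
  \<comment> \<open>The constant 1, integrated under \<open>P1\<close> and transferred to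
    \<open>P0\<close> through the derivative.\<close>
  have f_int: "integrable P0 f" "(\<integral>x. f x \<partial>P0) = 1"
    using P0.RN_deriv_integrable[of P1 "\<lambda>_. 1"] P0.RN_deriv_integral[of P1 "\<lambda>_. 1"] s ac
      P1.sigma_finite_measure_axioms by (simp_all add: f_def[abs_def] P1.prob_space)
  have chi_eq: "chi_square_div P1 P0 = (\<integral>\<^sup>+x. ennreal ((f x - 1)\<^sup>2) \<partial>P0)"
    by (simp add: chi_square_div_def f_def)
  \<comment> \<open>Finite divergence is square integrability of \<open>f - 1\<close>; an infinite
    value would be turned into 0 by \<open>enn2real\<close> in \<open>\<rho>\<close>.\<close>
  have f_sq: "integrable P0 (\<lambda>x. (f x - 1)\<^sup>2)"
    using chi by (intro integrableI_nonneg) (auto simp: chi_eq)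
  have \<rho>_sq: "(\<integral>x. (f x - 1)\<^sup>2 \<partial>P0) = \<rho>\<^sup>2"
    by (simp add: \<rho> chi_eq integral_eq_nn_integral)
  define q where "q x = 1 + a * (f x - 1)" for x
  have q_sq_eq: "(q x - 1)\<^sup>2 = a\<^sup>2 * (f x - 1)\<^sup>2" for x
    by (simp add: q_def power_mult_distrib)
  have q_nonneg: "0 \<le> q x" for x
  proof -
    have "q x = (1 - a) + a * f x" by (simp add: q_def algebra_simps)
    then show ?thesis using a f_nonneg[of x] by simp
  qed
  have mix: "mixture a P0 P1 = density P0 q"
    unfolding q_def f_def by (rule mixture_eq_density) fact+
  have "(\<integral>y. \<phi> y \<partial>iid m (density P0 q))
    \<le> (\<integral>y. \<phi> y \<partial>iid m P0) + sqrt ((1 + (\<integral>x. (q x - 1)\<^sup>2 \<partial>P0)) ^ m - 1)"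
  proof (rule power_le_level_iid_density[OF P0 _ q_nonneg _ _ _ \<phi>])
    show "q \<in> borel_measurable P0" unfolding q_def by measurable
    show "integrable P0 q" "(\<integral>x. q x \<partial>P0) = 1"
      unfolding q_def using f_int by (simp_all add: P0.prob_space)
    show "integrable P0 (\<lambda>x. (q x - 1)\<^sup>2)" unfolding q_sq_eq using f_sq by simp
  qed
  also have "(\<integral>x. (q x - 1)\<^sup>2 \<partial>P0) = (a * \<rho>)\<^sup>2"
    unfolding q_sq_eq by (simp add: \<rho>_sq power_mult_distrib)
  also have "(1 + (a * \<rho>)\<^sup>2) ^ m \<le> exp ((a * \<rho>)\<^sup>2) ^ m"
    by (intro power_mono) auto
  also have "\<dots> = exp ((a * \<rho> * sqrt m)\<^sup>2)"
    by (simp add: power_mult_distrib mult.commute flip: exp_of_nat_mult)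
  finally show ?thesis by (simp add: mix)
qed

theorem corollary4:
  fixes Y P0 P1 Q :: "nat \<Rightarrow> 'a measure"
    and \<tau> :: real and \<alpha> \<rho> \<pi> :: "nat \<Rightarrow> real"
    and \<phi> :: "nat \<Rightarrow> (nat \<Rightarrow> 'a) \<Rightarrow> real"
  assumes "0 < \<tau>" and "\<tau> < 1"
    and "\<And>m. m \<ge> 1 \<Longrightarrow> prob_space (P0 m)"
    and "\<And>m. m \<ge> 1 \<Longrightarrow> prob_space (P1 m)"
    and "\<And>m. m \<ge> 1 \<Longrightarrow> sets (P0 m) = sets (Y m)"
    and "\<And>m. m \<ge> 1 \<Longrightarrow> sets (P1 m) = sets (Y m)"
    and "\<And>m. m \<ge> 1 \<Longrightarrow> absolutely_continuous (P0 m) (P1 m)"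
    and "\<And>m. m \<ge> 1 \<Longrightarrow> chi_square_div (P1 m) (P0 m) < \<infinity>"
    and "\<And>m. m \<ge> 1 \<Longrightarrow> \<rho> m = sqrt (enn2real (chi_square_div (P1 m) (P0 m)))"
    and "\<And>m. m \<ge> 1 \<Longrightarrow> 0 \<le> \<alpha> m \<and> \<alpha> m \<le> 1"
    and "\<And>m. m \<ge> 1 \<Longrightarrow> Q m = mixture (\<alpha> m) (P0 m) (P1 m)"
    and "\<And>m. m \<ge> 1 \<Longrightarrow> is_test m (Y m) (\<phi> m)"
    and "limsup (\<lambda>m. ereal (\<integral>y. \<phi> m y \<partial>iid m (P0 m))) \<le> ereal \<tau>"
    and "\<And>m. m \<ge> 1 \<Longrightarrow> \<pi> m = (\<integral>y. \<phi> m y \<partial>iid m (Q m))"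
  shows "((\<lambda>m. \<alpha> m * \<rho> m * sqrt (real m)) \<longlonglongrightarrow> 0
            \<longrightarrow> limsup (\<lambda>m. ereal (\<pi> m)) \<le> ereal \<tau>)
       \<and> (liminf (\<lambda>m. ereal (\<pi> m)) > ereal \<tau>
            \<longrightarrow> liminf (\<lambda>m. ereal (\<alpha> m * \<rho> m * sqrt (real m))) > 0
              \<and> \<alpha> \<in> \<Omega>(\<lambda>m. 1 / (\<rho> m * sqrt (real m))))"
proof -
  define t where "t m = \<alpha> m * \<rho> m * sqrt (real m)" for m
  define e where "e m = (\<integral>y. \<phi> m y \<partial>iid m (P0 m))" for m
  have t_nonneg: "0 \<le> t m" if "m \<ge> 1" for m
    using assms(9,10)[OF that] by (simp add: t_def)
  have bound: "\<pi> m \<le> e m + sqrt (exp ((t m)\<^sup>2) - 1)" if m: "m \<ge> 1" for m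
  proof -
    \<comment> \<open>Being a test depends on the measurable sets only, so it passes from
      \<open>Y m\<close> to \<open>P0 m\<close>.\<close>
    have sets_eq: "sets (iid m (P0 m)) = sets (iid m (Y m))"
      using assms(5)[OF m] by (intro sets_PiM_cong) auto
    have "is_test m (P0 m) (\<phi> m)"
      using assms(12)[OF m] unfolding is_test_def sets_eq_imp_space_eq[OF sets_eq]
        measurable_cong_sets[OF sets_eq refl] .
    then show ?thesis
      unfolding assms(14)[OF m] assms(11)[OF m] e_def t_def
      using assms(3-10)[OF m] by (intro power_le_level_iid_mixture) auto
  qed
  have level: "\<forall>\<^sub>F m in sequentially. e m < \<tau> + \<epsilon>" if "\<epsilon> > 0" for \<epsilon>
  proof -
    have "limsup (\<lambda>m. ereal (e m)) < ereal (\<tau> + \<epsilon>)"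
      using assms(13) that by (auto simp: e_def[abs_def] intro: le_less_trans)
    from Limsup_lessD[OF this] show ?thesis by simp
  qed
  have part1: "limsup (\<lambda>m. ereal (\<pi> m)) \<le> ereal \<tau>" if "t \<longlonglongrightarrow> 0"
  proof (rule ereal_le_epsilon2)
    fix \<epsilon> :: real assume "0 < \<epsilon>"
    \<comment> \<open>The excess is continuous in \<open>t\<close> and vanishes at 0; it takes half
      of the slack \<open>\<epsilon>\<close>, the level the other half.\<close>
    have "(\<lambda>m. sqrt (exp ((t m)\<^sup>2) - 1)) \<longlonglongrightarrow> sqrt (exp (0\<^sup>2) - 1)"
      by (intro tendsto_intros that)
    then have "\<forall>\<^sub>F m in sequentially. sqrt (exp ((t m)\<^sup>2) - 1) < \<epsilon> / 2"
      using \<open>0 < \<epsilon>\<close> by (intro order_tendstoD) auto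
    moreover have "\<forall>\<^sub>F m in sequentially. e m < \<tau> + \<epsilon> / 2"
      using \<open>0 < \<epsilon>\<close> by (intro level) simp
    ultimately have "\<forall>\<^sub>F m in sequentially. ereal (\<pi> m) \<le> ereal (\<tau> + \<epsilon>)"
      using eventually_ge_at_top[of 1]
    proof eventually_elim
      case (elim m)
      then show ?case using bound[of m] by simp
    qed
    then show "limsup (\<lambda>m. ereal (\<pi> m)) \<le> ereal \<tau> + ereal \<epsilon>"
      by (intro Limsup_bounded) simp
  qed
  have part2: "\<exists>k>0. \<forall>\<^sub>F m in sequentially. k \<le> t m"
    if "liminf (\<lambda>m. ereal (\<pi> m)) > ereal \<tau>"
  proof -
    from ereal_dense2[OF that] obtain c where c: "ereal \<tau> < ereal c" "ereal c < liminf (\<lambda>m. ereal (\<pi> m))"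
      by blast
    \<comment> \<open>Half the gap absorbs the fluctuation of the level; the other half must come
      from the excess.\<close>
    define \<epsilon> where "\<epsilon> = (c - \<tau>) / 2"
    have \<epsilon>: "0 < \<epsilon>" "c = \<tau> + 2 * \<epsilon>" using c by (auto simp: \<epsilon>_def field_simps)
    \<comment> \<open>Solves \<open>sqrt (exp (k\<^sup>2) - 1) = \<epsilon>\<close>: for
      \<open>t m\<close> below \<open>k\<close>, the excess cannot fill its half of the gap.\<close>
    define k where "k = sqrt (ln (1 + \<epsilon>\<^sup>2))"
    have k: "0 < k" "k\<^sup>2 = ln (1 + \<epsilon>\<^sup>2)"
      using \<epsilon>(1) ln_gt_zero[of "1 + \<epsilon>\<^sup>2"] by (simp_all add: k_def)
    from less_LiminfD[OF c(2)] level[OF \<epsilon>(1)] eventually_ge_at_top[of 1]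
    have "\<forall>\<^sub>F m in sequentially. k \<le> t m"
    proof eventually_elim
      case (elim m)
      then have gap: "\<epsilon> < sqrt (exp ((t m)\<^sup>2) - 1)" using bound[of m] \<epsilon> by simp
      show ?case
      proof (rule ccontr)
        assume "\<not> k \<le> t m"
        then have "(t m)\<^sup>2 \<le> k\<^sup>2" using t_nonneg[of m] elim by (intro power_mono) auto
        then have "exp ((t m)\<^sup>2) \<le> exp (ln (1 + \<epsilon>\<^sup>2))" by (simp only: k exp_le_cancel_iff)
        also have "\<dots> = 1 + \<epsilon>\<^sup>2" by (simp add: add_pos_nonneg)
        finally have "sqrt (exp ((t m)\<^sup>2) - 1) \<le> \<epsilon>"
          using \<epsilon>(1) by (intro real_le_lsqrt) auto
        with gap show False by simp
      qed
    qed
    with k show ?thesis by blast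
  qed
  have "liminf (\<lambda>m. ereal (t m)) > 0 \<and> \<alpha> \<in> \<Omega>(\<lambda>m. 1 / (\<rho> m * sqrt (real m)))"
    if lim: "liminf (\<lambda>m. ereal (\<pi> m)) > ereal \<tau>"
  proof
    obtain k where k: "0 < k" and ev: "\<forall>\<^sub>F m in sequentially. k \<le> t m" using part2[OF lim] by blast
    have "ereal k \<le> liminf (\<lambda>m. ereal (t m))"
      using ev by (intro Liminf_bounded) simp
    with k show "liminf (\<lambda>m. ereal (t m)) > 0" by (auto intro: less_le_trans[of _ "ereal k"])
    show "\<alpha> \<in> \<Omega>(\<lambda>m. 1 / (\<rho> m * sqrt (real m)))"
    \<comment> \<open>The same \<open>k\<close> serves as Landau constant. Since \<open>t m\<close>
      is eventually at least \<open>k > 0\<close>, eventually \<open>\<rho> m\<close> is nonzero and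
      the quotient is not the default value of division by zero.\<close>
    proof (rule landau_omega.bigI[OF k])
      from ev eventually_ge_at_top[of 1]
      show "\<forall>\<^sub>F m in sequentially. norm (\<alpha> m) \<ge> k * norm (1 / (\<rho> m * sqrt (real m)))"
      proof eventually_elim
        case (elim m)
        then have "\<rho> m \<noteq> 0" "0 \<le> \<rho> m" "0 \<le> \<alpha> m"
          using k assms(9,10)[of m] by (auto simp: t_def)
        then show ?case using elim by (simp add: t_def field_simps)
      qed
    qed
  qed
  with part1 show ?thesis by (auto simp: t_def[abs_def])
qed

end
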